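(* Let $d\ge1$, let $\mathcal{K}$ be an admissible $d$-complex with oriented facets $F_1,\dots,F_n$, and for each $m$ let $S_m$ be the set of oriented $m$-simplices on the vertices of $\mathcal{K}$. Suppose $\phi:S_d\to\mathbb{R}$ is a function such that: (1) for any $T\in S_d$, with $T'$ its oppositely oriented version, $\phi(T)=-\phi(T')$; (2) for any $T\in S_{d+1}$, with oriented boundary facets $B_1,\dots,B_{d+2}$, one has $\phi(B_1)+\dots+\phi(B_{d+2})\le 1$. Then $$\phi(F_1)+\dots+\phi(F_n)\le V_{\mathbb{Q}}(\mathcal{K}).$$
   Context: An admissible $d$-complex is a finite pure simplicial $d$-complex $\mathcal{K}$ (every simplex is a face of a $d$-simplex of $\mathcal{K}$) in which each facet ($d$-simplex) is equipped with an orientation, giving oriented facets $F_1,\dots,F_n$ (each facet occurring once), such that $\sum_i\partial F_i=0$. We also write $\mathcal{K}$ for the $d$-chain $\sum_i F_i$. An oriented $m$-simplex on the vertices of $\mathcal{K}$ is any set of $m+1$ distinct vertices of $\mathcal{K}$ (not necessarily spanning a simplex of $\mathcal{K}$) with an orientation. $C_m(\mathcal{K};\mathbb{Q})$ denotes the group of $m$-chains of such simplices with rational coefficients, where an oriented simplex with reversed orientation equals minus the original. The boundary is $\partial[v_0,\dots,v_m]=\sum_i(-1)^i[v_0,\dots,\widehat{v_i},\dots,v_m]$; the oriented boundary facets of $T\in S_{d+1}$ are the oriented $d$-simplices $B_1,\dots,B_{d+2}$, with induced orientation, such that $\partial T=B_1+\dots+B_{d+2}$. For a chain $\alpha$, $|\alpha|_1$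 is the sum of the absolute values of its coefficients (with one chosen orientation per simplex). $V_{\mathbb{Q}}(\mathcal{K})$ is the minimum of $|\alpha|_1$ over all $\alpha\in C_{d+1}(\mathcal{K};\mathbb{Q})$ with $\partial\alpha=\mathcal{K}$. *)

theory Defs
  imports Complex_Main "HOL-Library.Function_Algebras" "HOL-Combinatorics.Permutations"
begin

text \<open>
  An oriented simplex with reversed orientation is minus the original, so a rational chain is
  encoded as a function on ordered vertex tuples which changes by the sign under a permutation
  of the tuple; its value at \<open>[v\<^sub>0, \<dots>, v\<^sub>m]\<close> is the coefficient of the simplex
  \<open>{v\<^sub>0, \<dots>, v\<^sub>m}\<close> with respect to the orientation given by this ordering. Addition,
  negation and zero of chains are pointwise.
\<close>

type_synonym 'a chain = "'a list \<Rightarrow> rat"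

definition scale_chain :: "rat \<Rightarrow> 'a chain \<Rightarrow> 'a chain" where
  "scale_chain a c = (\<lambda>xs. a * c xs)"

definition ordered_simplices :: "'a set \<Rightarrow> nat \<Rightarrow> 'a list set" where
  "ordered_simplices V m = {xs. distinct xs \<and> set xs \<subseteq> V \<and> length xs = Suc m}"

text \<open>
  The oriented simplex \<open>[v\<^sub>0, \<dots>, v\<^sub>m]\<close> as a chain: if the vertices are distinct, at most one
  permutation contributes to the sum.
\<close>

definition osimplex :: "'a list \<Rightarrow> 'a chain" where
  "osimplex xs = (\<lambda>ys. \<Sum>p | p permutes {..<length xs} \<and> permute_list p xs = ys. of_int (sign p))"

lemma osimplex_permute_list:
  assumes q: "q permutes {..<length xs}"
  shows "osimplex (permute_list q xs) = scale_chain (of_int (sign q)) (osimplex xs)"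
proof
  fix ys
  let ?S = "{..<length xs}"
  have "osimplex (permute_list q xs) ys
      = (\<Sum>p | p permutes ?S \<and> permute_list (q \<circ> p) xs = ys. of_int (sign p))"
    unfolding osimplex_def
    by (rule sum.cong) (auto simp: permute_list_compose)
  also have "\<dots> = (\<Sum>r | r permutes ?S \<and> permute_list r xs = ys. of_int (sign q * sign r))"
  proof (rule sum.reindex_bij_witness[where j = "\<lambda>p. q \<circ> p" and i = "\<lambda>r. inv q \<circ> r"], goal_cases)
    case (1 p)
    then show ?case using permutes_inv_o(2)[OF q] by (simp add: o_assoc)
  next
    case (2 p)
    then show ?case using q by (auto intro: permutes_compose)
  next
    case (3 r)
    then show ?case using permutes_inv_o(1)[OF q] by (simp add: o_assoc)
  next
    case (4 r)
    then show ?case using permutes_inv_o(1)[OF q] permutes_inv[OF q]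
      by (auto simp: o_assoc intro: permutes_compose)
  next
    case (5 p)
    have "permutation q" "permutation p"
      using 5 q by (auto intro: permutes_imp_permutation[of ?S])
    then show ?case by (simp add: sign_compose)
  qed
  also have "\<dots> = scale_chain (of_int (sign q)) (osimplex xs) ys"
    by (simp add: osimplex_def scale_chain_def sum_distrib_left)
  finally show "osimplex (permute_list q xs) ys = \<dots>" .
qed

lemma osimplex_self:
  assumes "distinct xs"
  shows "osimplex xs xs = 1"
proof -
  have "p = id" if p: "p permutes {..<length xs}" and e: "permute_list p xs = xs" for p
  proof
    fix i
    show "p i = id i"
    proof (cases "i < length xs")
      case True
      then have "p i < length xs" using permutes_in_image[OF p, of i] by simp
      moreover have "xs ! p i = xs ! i" using permute_list_nth[OF p True] e by simp
      ultimately show ?thesis using assms True by (simp add: nth_eq_iff_index_eq)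
    next
      case False
      then show ?thesis using permutes_not_in[OF p, of i] by simp
    qed
  qed
  then have "{p. p permutes {..<length xs} \<and> permute_list p xs = xs} = {id}"
    by (auto simp: permutes_id)
  then show ?thesis by (simp add: osimplex_def)
qed

text \<open>
  The set \<open>S\<^sub>m\<close> of oriented \<open>m\<close>-simplices on the vertex set \<open>V\<close>. The negatives only matter for
  \<open>m = 0\<close>; otherwise they arise by transposing two vertices.
\<close>

definition oriented_simplices :: "'a set \<Rightarrow> nat \<Rightarrow> 'a chain set" where
  "oriented_simplices V m =
     {T. \<exists>xs \<in> ordered_simplices V m. T = osimplex xs \<or> T = - osimplex xs}"

definition chains :: "'a set \<Rightarrow> nat \<Rightarrow> 'a chain set" where
  "chains V m = {c. (\<forall>xs. c xs \<noteq> 0 \<longrightarrow> xs \<in> ordered_simplices V m) \<and>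
     (\<forall>xs p. p permutes {..<length xs} \<longrightarrow> c (permute_list p xs) = of_int (sign p) * c xs)}"

definition osimplex_boundary :: "'a list \<Rightarrow> 'a chain" where
  "osimplex_boundary xs =
     (\<Sum>i<length xs. scale_chain ((-1) ^ i) (osimplex (take i xs @ drop (Suc i) xs)))"

text \<open>One chosen orientation per simplex; all uses below are independent of the choice.\<close>

definition chosen_order :: "'a set \<Rightarrow> 'a list" where
  "chosen_order A = (SOME xs. distinct xs \<and> set xs = A)"

definition boundary :: "'a set \<Rightarrow> nat \<Rightarrow> 'a chain \<Rightarrow> 'a chain" where
  "boundary V m c = (\<Sum>A | A \<subseteq> V \<and> card A = Suc m.
     scale_chain (c (chosen_order A)) (osimplex_boundary (chosen_order A)))"

definition l1_norm :: "'a set \<Rightarrow> nat \<Rightarrow> 'a chain \<Rightarrow> rat" where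
  "l1_norm V m c = (\<Sum>A | A \<subseteq> V \<and> card A = Suc m. \<bar>c (chosen_order A)\<bar>)"

text \<open>
  \<open>B 0, \<dots>, B (d + 1)\<close> are the oriented boundary facets of \<open>T\<close>. As \<open>\<partial>T\<close> is a combination of
  \<open>d + 2\<close> distinct simplices with coefficients \<open>\<plusminus>1\<close>, no cancellation is possible on the right and
  the \<open>B i\<close> are determined up to order: they carry the induced orientations.
\<close>

definition boundary_facets :: "'a set \<Rightarrow> nat \<Rightarrow> 'a chain \<Rightarrow> (nat \<Rightarrow> 'a chain) \<Rightarrow> bool" where
  "boundary_facets V d T B \<longleftrightarrow>
     (\<forall>i < d + 2. B i \<in> oriented_simplices V d) \<and>
     boundary V (Suc d) T = (\<Sum>i < d + 2. B i)"

text \<open>Simplices of an abstract complex are its nonempty faces, given by their vertex sets.\<close>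

definition abstract_simplicial_complex :: "'a set set \<Rightarrow> bool" where
  "abstract_simplicial_complex K \<longleftrightarrow>
     (\<forall>s \<in> K. finite s \<and> s \<noteq> {}) \<and> (\<forall>s \<in> K. \<forall>t. t \<subseteq> s \<and> t \<noteq> {} \<longrightarrow> t \<in> K)"

definition facets :: "nat \<Rightarrow> 'a set set \<Rightarrow> 'a set set" where
  "facets d K = {s \<in> K. card s = Suc d}"

definition pure_complex :: "nat \<Rightarrow> 'a set set \<Rightarrow> bool" where
  "pure_complex d K \<longleftrightarrow> (\<forall>s \<in> K. \<exists>t \<in> facets d K. s \<subseteq> t)"

text \<open>
  The map \<open>F\<close> equips each facet with an orientation. Since a facet \<open>s\<close> has exactly \<open>d + 1\<close>
  vertices, \<open>oriented_simplices s d\<close> consists of the two orientations of \<open>s\<close> itself.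
\<close>

definition admissible_complex :: "nat \<Rightarrow> 'a set set \<Rightarrow> ('a set \<Rightarrow> 'a chain) \<Rightarrow> bool" where
  "admissible_complex d K F \<longleftrightarrow>
     finite K \<and> abstract_simplicial_complex K \<and> pure_complex d K \<and>
     (\<forall>s \<in> facets d K. F s \<in> oriented_simplices s d) \<and>
     (\<Sum>s \<in> facets d K. boundary (\<Union>K) d (F s)) = 0"

definition complex_chain :: "nat \<Rightarrow> 'a set set \<Rightarrow> ('a set \<Rightarrow> 'a chain) \<Rightarrow> 'a chain" where
  "complex_chain d K F = (\<Sum>s \<in> facets d K. F s)"

definition V_rat :: "nat \<Rightarrow> 'a set set \<Rightarrow> ('a set \<Rightarrow> 'a chain) \<Rightarrow> rat" where
  "V_rat d K F = (LEAST r. \<exists>\<alpha> \<in> chains (\<Union>K) (Suc d).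
     boundary (\<Union>K) (Suc d) \<alpha> = complex_chain d K F \<and> r = l1_norm (\<Union>K) (Suc d) \<alpha>)"

end

theory Submission
  imports Defs
begin

text \<open>
  The inequality is weak linear programming duality. As \<open>\<phi>\<close> is odd, it extends to a linear functional
  on \<open>d\<close>-chains whose value on every oriented simplex is still that of \<open>\<phi>\<close>, so its value on the
  complex is \<open>\<Sum> \<phi> (F s)\<close>. The second hypothesis, applied to a \<open>(d + 1)\<close>-simplex with both of its
  orientations, bounds the functional by 1 in absolute value on the boundary of that simplex. Hence
  every filling \<open>\<alpha>\<close> of the complex satisfies \<open>\<Sum> \<phi> (F s) \<le> |\<alpha>|\<^sub>1\<close>: this is \<open>linear_ext_boundary_le\<close>.

  As the filling volume is defined as a least rational number, it must also be shown that the
  minimum over the fillings is attained (\<open>minimal_filling\<close>). This takes two ingredients. A filling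
  exists (\<open>cycle_has_filling\<close>), namely a cone over the cycle, because all simplices on the vertex
  set are allowed. And the norm attains its minimum on the affine space of fillings
  (\<open>l1_min_attained\<close>), because every filling can be replaced, without increasing the norm, by one
  whose support carries no nonzero cycle, and there are only finitely many of those.

  Boundaries are handled through the formula \<open>(\<partial>c) ys = \<Sum>w\<in>V. c (w # ys)\<close> (\<open>boundary_coeff\<close>), which
  involves neither signs nor chosen orderings.
\<close>

section \<open>Minimising the l1 norm on an affine space\<close>

text \<open>
  On the ray \<open>x + t z\<close> (after possibly replacing \<open>z\<close> by \<open>- z\<close>) the norm is nonincreasing for
  \<open>t \<ge> 0\<close> until some nonzero coordinate reaches zero; stopping there shrinks the support.
\<close>

lemma l1_reduce_support:
  fixes I :: "'i set" and x z :: "'i \<Rightarrow> 'f::linordered_field"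
  assumes I: "finite I"
    and supp: "\<And>i. i \<in> I \<Longrightarrow> x i = 0 \<Longrightarrow> z i = 0"
    and nz: "\<exists>i\<in>I. z i \<noteq> 0"
  obtains t where "(\<Sum>i\<in>I. \<bar>x i + t * z i\<bar>) \<le> (\<Sum>i\<in>I. \<bar>x i\<bar>)"
    and "{i\<in>I. x i + t * z i \<noteq> 0} \<subset> {i\<in>I. x i \<noteq> 0}"
proof -
  have main: "\<exists>t. (\<Sum>i\<in>I. \<bar>x i + t * z i\<bar>) \<le> (\<Sum>i\<in>I. \<bar>x i\<bar>) \<and>
      {i\<in>I. x i + t * z i \<noteq> 0} \<subset> {i\<in>I. x i \<noteq> 0}"
    if supp: "\<And>i. i \<in> I \<Longrightarrow> x i = 0 \<Longrightarrow> z i = 0" and nz: "\<exists>i\<in>I. z i \<noteq> 0"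
      and le: "(\<Sum>i\<in>I. sgn (x i) * z i) \<le> 0" for z
  proof -
    \<comment> \<open>\<open>N\<close> collects the coordinates that move towards zero as \<open>t\<close> grows.\<close>
    define N where "N = {i\<in>I. sgn (x i) * z i < 0}"
    have "N \<noteq> {}"
    proof
      assume "N = {}"
      then have nn: "\<forall>i\<in>I. 0 \<le> sgn (x i) * z i" by (auto simp: N_def not_less)
      then have "(\<Sum>i\<in>I. sgn (x i) * z i) = 0" using le by (simp add: sum_nonneg antisym)
      then have "\<forall>i\<in>I. sgn (x i) * z i = 0" using nn I by (simp add: sum_nonneg_eq_0_iff)
      then show False using nz supp by (auto simp: sgn_0_0)
    qed
    have finN: "finite N" using I by (simp add: N_def)
    \<comment> \<open>The first time at which a coordinate reaches zero.\<close>
    define t where "t = Min ((\<lambda>i. - x i / z i) ` N)"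
    have "t \<in> (\<lambda>i. - x i / z i) ` N"
      unfolding t_def using finN \<open>N \<noteq> {}\<close> by (intro Min_in) auto
    then obtain k where k: "k \<in> N" "t = - x k / z k" by blast
    have tle: "t \<le> - x i / z i" if "i \<in> N" for i
      unfolding t_def using finN that by simp
    have signs: "0 < x i \<and> z i < 0 \<or> x i < 0 \<and> 0 < z i" if "i \<in> N" for i
      using that by (auto simp: N_def sgn_if mult_less_0_iff split: if_splits)
    have t0: "0 \<le> t" using signs[OF k(1)] k(2) by (auto simp: divide_nonpos_pos divide_nonpos_neg divide_le_0_iff)
    have sgn_nonneg: "0 \<le> sgn (x i) * (x i + t * z i)" if "i \<in> I" for i
    proof (cases "i \<in> N")
      case True
      show ?thesis
      proof (cases "0 < x i")
        case True
        with \<open>i \<in> N\<close> have "z i < 0" by (auto simp: N_def)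
        with tle[OF \<open>i \<in> N\<close>] True show ?thesis by (simp add: divide_simps)
      next
        case False
        with \<open>i \<in> N\<close> have "z i > 0" "x i < 0"
          by (auto simp: N_def sgn_if mult_less_0_iff split: if_splits)
        with tle[OF \<open>i \<in> N\<close>] show ?thesis by (simp add: divide_simps)
      qed
    next
      case False
      then have "0 \<le> sgn (x i) * z i" using that by (auto simp: N_def)
      then have "0 \<le> t * (sgn (x i) * z i)" using t0 by simp
      moreover have "sgn (x i) * x i = \<bar>x i\<bar>" by (simp add: sgn_if)
      ultimately show ?thesis
        by (metis abs_ge_zero add_nonneg_nonneg distrib_left mult.left_commute)
    qed
    have abs_eq: "\<bar>x i + t * z i\<bar> = \<bar>x i\<bar> + t * (sgn (x i) * z i)" if "i \<in> I" for i
      using sgn_nonneg[OF that] supp[OF that] by (auto simp: sgn_if split: if_splits)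
    have "(\<Sum>i\<in>I. \<bar>x i + t * z i\<bar>) = (\<Sum>i\<in>I. \<bar>x i\<bar>) + t * (\<Sum>i\<in>I. sgn (x i) * z i)"
      by (simp add: abs_eq sum.distrib sum_distrib_left)
    also have "\<dots> \<le> (\<Sum>i\<in>I. \<bar>x i\<bar>)" using t0 le by (simp add: mult_nonneg_nonpos)
    finally have 1: "(\<Sum>i\<in>I. \<bar>x i + t * z i\<bar>) \<le> (\<Sum>i\<in>I. \<bar>x i\<bar>)" .
    have "k \<in> I" "x k \<noteq> 0" "x k + t * z k = 0"
      using k by (auto simp: N_def)
    then have "{i\<in>I. x i + t * z i \<noteq> 0} \<subset> {i\<in>I. x i \<noteq> 0}"
      using supp by fastforce
    with 1 show ?thesis by blast
  qed
  show thesis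
  proof (cases "(\<Sum>i\<in>I. sgn (x i) * z i) \<le> 0")
    case True
    then show ?thesis using main[OF supp nz] that by blast
  next
    case False
    then have "(\<Sum>i\<in>I. sgn (x i) * (- z i)) \<le> 0" by (simp add: sum_negf)
    then obtain t where "(\<Sum>i\<in>I. \<bar>x i + t * (- z i)\<bar>) \<le> (\<Sum>i\<in>I. \<bar>x i\<bar>)"
        "{i\<in>I. x i + t * (- z i) \<noteq> 0} \<subset> {i\<in>I. x i \<noteq> 0}"
      using main[of "\<lambda>i. - z i"] supp nz by auto
    then show ?thesis using that[of "- t"] by simp
  qed
qed

text \<open>
  An \<open>\<ell>\<^sup>1\<close> seminorm attains its minimum on every nonempty affine family, over any ordered field.
  No compactness is available over the rationals. Instead, the norm is reduced to the members \<open>x\<close>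
  whose support carries no nonzero difference of two members; such an \<open>x\<close> is determined on \<open>I\<close> by
  its support, so only finitely many values of the norm compete.
\<close>

lemma l1_min_attained:
  fixes I :: "'i set" and X :: "('i \<Rightarrow> 'f::linordered_field) set"
  assumes I: "finite I" and ne: "X \<noteq> {}"
    and aff: "\<And>x y w t. x \<in> X \<Longrightarrow> y \<in> X \<Longrightarrow> w \<in> X \<Longrightarrow> (\<lambda>i. x i + t * (y i - w i)) \<in> X"
  obtains x where "x \<in> X" "\<And>y. y \<in> X \<Longrightarrow> (\<Sum>i\<in>I. \<bar>x i\<bar>) \<le> (\<Sum>i\<in>I. \<bar>y i\<bar>)"
proof -
  define S where "S x = {i\<in>I. x i \<noteq> 0}" for x :: "'i \<Rightarrow> 'f"
  define n where "n x = (\<Sum>i\<in>I. \<bar>x i\<bar>)" for x :: "'i \<Rightarrow> 'f"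
  define R where "R = {x\<in>X. \<forall>y\<in>X. \<forall>w\<in>X. S (\<lambda>i. y i - w i) \<subseteq> S x \<longrightarrow> (\<forall>i\<in>I. y i = w i)}"
  have red: "\<exists>y\<in>R. n y \<le> n x" if "x \<in> X" for x
    using that
  proof (induction "card (S x)" arbitrary: x rule: less_induct)
    case less
    show ?case
    proof (cases "x \<in> R")
      case False
      with \<open>x \<in> X\<close> obtain y w i where yw: "y \<in> X" "w \<in> X" "S (\<lambda>i. y i - w i) \<subseteq> S x"
          "i \<in> I" "y i \<noteq> w i" by (auto simp: R_def)
      obtain t where t: "n (\<lambda>i. x i + t * (y i - w i)) \<le> n x"
          "S (\<lambda>i. x i + t * (y i - w i)) \<subset> S x"
        unfolding n_def S_def
        by (rule l1_reduce_support[OF I, of x "\<lambda>i. y i - w i"]) (use yw in \<open>auto simp: S_def\<close>)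
      have "card (S (\<lambda>i. x i + t * (y i - w i))) < card (S x)"
        using t(2) I by (intro psubset_card_mono) (auto simp: S_def)
      from less.hyps[OF this aff[OF \<open>x \<in> X\<close> yw(1,2)]] t(1) show ?thesis
        by (meson order.trans)
    qed auto
  qed
  have n_eq: "n x = n y" if "x \<in> R" "y \<in> R" "S x = S y" for x y
  proof -
    have "i \<in> S x" if "i \<in> S (\<lambda>i. x i - y i)" for i
    proof (rule ccontr)
      assume "i \<notin> S x"
      with \<open>S x = S y\<close> have "i \<notin> S x" "i \<notin> S y" by blast+
      then show False using \<open>i \<in> S (\<lambda>i. x i - y i)\<close> by (simp add: S_def)
    qed
    then have sub: "S (\<lambda>i. x i - y i) \<subseteq> S x" by blast
    have "x \<in> X" "y \<in> X" using that by (simp_all add: R_def)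
    then have "\<forall>i\<in>I. x i = y i" using that(1) sub unfolding R_def by blast
    then show ?thesis by (simp add: n_def)
  qed
  \<comment> \<open>On \<open>R\<close> the norm factors through the support, a subset of the finite set \<open>I\<close>.\<close>
  define pick where "pick s = (SOME x. x \<in> R \<and> S x = s)" for s
  have "n x = n (pick (S x))" if "x \<in> R" for x
  proof -
    have "pick (S x) \<in> R \<and> S (pick (S x)) = S x"
      unfolding pick_def by (rule someI[of _ x]) (simp add: that)
    then show ?thesis using n_eq[of x "pick (S x)"] that by simp
  qed
  then have "n ` R = (\<lambda>s. n (pick s)) ` S ` R" by (force simp: image_image)
  moreover have "finite (S ` R)"
    using I by (rule finite_subset[rotated, OF finite_Pow_iff[THEN iffD2]]) (auto simp: S_def)
  ultimately have fin: "finite (n ` R)" by simp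
  have "n ` R \<noteq> {}" using red ne by blast
  then obtain x where x: "x \<in> R" "n x = Min (n ` R)"
    using Min_in[OF fin] by fastforce
  have "n x \<le> n y" if "y \<in> X" for y
    using red[OF that] Min_le[OF fin] x(2) by fastforce
  moreover have "x \<in> X" using x(1) by (simp add: R_def)
  ultimately show ?thesis using that unfolding n_def by blast
qed

section \<open>Alternating functions and oriented simplices\<close>

lemma sum_fun_apply: "(\<Sum>i\<in>I. f i) x = (\<Sum>i\<in>I. f i x)"
  for f :: "'i \<Rightarrow> 'x \<Rightarrow> 'y::comm_monoid_add"
  by (induction I rule: infinite_finite_induct) (auto simp: zero_fun_def plus_fun_def)

text \<open>
  Functions on vertex tuples that change by the sign under permutations: the symmetry condition in
  the definition of chains, without the condition on the support.
\<close>

definition alternating :: "'a chain \<Rightarrow> bool" where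
  "alternating c \<longleftrightarrow>
     (\<forall>xs p. p permutes {..<length xs} \<longrightarrow> c (permute_list p xs) = of_int (sign p) * c xs)"

lemma chains_iff:
  "c \<in> chains V m \<longleftrightarrow> (\<forall>xs. c xs \<noteq> 0 \<longrightarrow> xs \<in> ordered_simplices V m) \<and> alternating c"
  by (simp add: chains_def alternating_def)

lemma alternatingD:
  "alternating c \<Longrightarrow> p permutes {..<length xs} \<Longrightarrow> c (permute_list p xs) = of_int (sign p) * c xs"
  by (simp add: alternating_def)

text \<open>
  Fixing the first vertex preserves the sign rule. The permutation of the tail is decomposed into
  transpositions, so that the sign of an index-shifted permutation is never needed.
\<close>

lemma alternating_Cons:
  assumes c: "alternating c"
  shows "alternating (\<lambda>xs. c (x # xs))"
  unfolding alternating_def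
proof (intro allI impI)
  fix xs :: "'a list" and p
  assume "p permutes {..<length xs}"
  then have "\<forall>ys. length ys = length xs \<longrightarrow> c (x # permute_list p ys) = of_int (sign p) * c (x # ys)"
    using finite_lessThan[of "length xs"]
  proof (induction rule: permutes_induct)
    case id
    then show ?case by simp
  next
    case (swap a b p)
    show ?case
    proof (intro allI impI)
      fix ys :: "'a list"
      assume len: "length ys = length xs"
      let ?t = "Transposition.transpose a b" and ?t' = "Transposition.transpose (Suc a) (Suc b)"
      have t: "?t permutes {..<length ys}" and t': "?t' permutes {..<length (x # ys)}"
        using swap len by (auto intro!: permutes_swap_id)
      have "x # permute_list ?t ys = permute_list ?t' (x # ys)"
      proof (rule nth_equalityI)
        fix i assume "i < length (x # permute_list ?t ys)"
        then show "(x # permute_list ?t ys) ! i = permute_list ?t' (x # ys) ! i"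
          using t t' by (cases i) (auto simp: permute_list_nth transpose_def nth_Cons)
      qed simp
      then have "c (x # permute_list ?t ys) = - c (x # ys)"
        using alternatingD[OF c t'] \<open>a \<noteq> b\<close> by (simp add: sign_swap_id)
      moreover have "permutation p" using swap by (auto intro: permutes_imp_permutation)
      ultimately show "c (x # permute_list (?t \<circ> p) ys) = of_int (sign (?t \<circ> p)) * c (x # ys)"
        using swap len
        by (simp add: permute_list_compose sign_compose permutation_swap_id sign_swap_id)
    qed
  qed
  then show "c (x # permute_list p xs) = of_int (sign p) * c (x # xs)" by simp
qed

lemma alternating_swap_first:
  assumes c: "alternating c"
  shows "c (x # y # xs) = - c (y # x # xs)"
proof -
  let ?t = "Transposition.transpose 0 (Suc 0)"
  have t: "?t permutes {..<length (y # x # xs)}" by (auto intro!: permutes_swap_id)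
  have "permute_list ?t (y # x # xs) = x # y # xs"
  proof (rule nth_equalityI)
    fix i assume "i < length (permute_list ?t (y # x # xs))"
    then show "permute_list ?t (y # x # xs) ! i = (x # y # xs) ! i"
      using t by (auto simp: permute_list_nth transpose_def nth_Cons split: nat.split)
  qed simp
  then show ?thesis using alternatingD[OF c t] by (simp add: sign_swap_id)
qed

lemma alternating_move_front:
  "alternating c \<Longrightarrow> c (as @ x # bs) = (-1) ^ length as * c (x # as @ bs)"
proof (induction as arbitrary: c)
  case (Cons a as)
  have "c ((a # as) @ x # bs) = (-1) ^ length as * c (a # x # as @ bs)"
    using Cons.IH[OF alternating_Cons[OF Cons.prems, of a]] by simp
  then show ?case using alternating_swap_first[OF Cons.prems, of a x "as @ bs"] by simp
qed simp

lemma alternating_eqI: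
  assumes "alternating c" "alternating c'" "mset ys = mset xs" "c xs = c' xs"
  shows "c ys = c' ys"
  using assms by (metis mset_eq_permutation alternatingD)

lemma alternating_sum_scale:
  "(\<And>i. i \<in> I \<Longrightarrow> alternating (f i)) \<Longrightarrow> alternating (\<Sum>i\<in>I. scale_chain (a i) (f i))"
  by (auto simp: alternating_def sum_fun_apply scale_chain_def sum_distrib_left algebra_simps
      intro!: sum.cong)

lemma osimplex_eq_0: "mset ys \<noteq> mset xs \<Longrightarrow> osimplex xs ys = 0"
  unfolding osimplex_def by (rule sum.neutral) auto

lemma osimplex_permuted_self:
  assumes "distinct xs" "p permutes {..<length xs}"
  shows "osimplex xs (permute_list p xs) = of_int (sign p)"
proof -
  have "of_int (sign p) * osimplex xs (permute_list p xs) = 1"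
    using osimplex_permute_list[OF assms(2)] osimplex_self[of "permute_list p xs"] assms
    by (simp add: scale_chain_def)
  then show ?thesis by (auto simp: sign_def split: if_splits)
qed

lemma alternating_osimplex:
  assumes "distinct xs"
  shows "alternating (osimplex xs)"
  unfolding alternating_def
proof (intro allI impI)
  fix ys :: "'a list" and p
  assume p: "p permutes {..<length ys}"
  show "osimplex xs (permute_list p ys) = of_int (sign p) * osimplex xs ys"
  proof (cases "mset ys = mset xs")
    case True
    then obtain q where q: "q permutes {..<length xs}" "ys = permute_list q xs"
      by (metis mset_eq_permutation)
    have p': "p permutes {..<length xs}" using p q by simp
    have "permutation p" "permutation q" using p' q by (auto intro: permutes_imp_permutation)
    then show ?thesis
      using assms q p' permutes_compose[OF p' q(1)]
      by (simp add: osimplex_permuted_self sign_compose flip: permute_list_compose)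
  next
    case False
    then show ?thesis using p by (simp add: osimplex_eq_0)
  qed
qed

lemma osimplex_in_chains:
  assumes "xs \<in> ordered_simplices V m"
  shows "osimplex xs \<in> chains V m"
proof -
  have "ys \<in> ordered_simplices V m" if "osimplex xs ys \<noteq> 0" for ys
  proof -
    have "mset ys = mset xs" using that osimplex_eq_0 by blast
    then have "distinct ys = distinct xs" "set ys = set xs" "length ys = length xs"
      using mset_eq_imp_distinct_iff mset_eq_setD mset_eq_length by blast+
    then show ?thesis using assms by (simp add: ordered_simplices_def)
  qed
  then show ?thesis
    using assms by (auto simp: chains_iff ordered_simplices_def intro: alternating_osimplex)
qed

lemma osimplex_Cons:
  assumes "distinct (x # xs)"
  shows "osimplex (x # xs) (x # ys) = osimplex xs ys"
proof (cases "mset ys = mset xs")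
  case True
  have "distinct xs" using assms by simp
  then show ?thesis
    using alternating_eqI[OF alternating_Cons[OF alternating_osimplex[OF assms], of x]
        alternating_osimplex True]
    by (simp only: osimplex_self assms)
qed (simp add: osimplex_eq_0)

text \<open>
  Here the sign rule is applied to \<open>osimplex xs ys\<close> as a function of the base simplex \<open>xs\<close>.
\<close>

lemma osimplex_move_front:
  assumes "distinct (as @ x # bs)"
  shows "osimplex (as @ x # bs) ys = (-1) ^ length as * osimplex (x # as @ bs) ys"
proof -
  have "alternating (\<lambda>xs. osimplex xs ys)"
    by (auto simp: alternating_def osimplex_permute_list scale_chain_def)
  then show ?thesis by (rule alternating_move_front)
qed

text \<open>
  The coefficient of \<open>ys\<close> in the boundary is the sum of the coefficients of the simplices
  \<open>w # ys\<close>. The right-hand side depends on \<open>xs\<close> only through the oriented simplex, so the same holds for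
  the boundary.
\<close>

lemma osimplex_boundary_coeff:
  assumes V: "finite V" and xs: "distinct xs" "set xs \<subseteq> V"
  shows "osimplex_boundary xs ys = (\<Sum>w\<in>V. osimplex xs (w # ys))"
proof -
  have "osimplex xs (w # ys) = 0" if "w \<notin> set xs" for w
    using that by (intro osimplex_eq_0) (metis list.set_intros(1) set_mset_mset)
  then have "(\<Sum>w\<in>V. osimplex xs (w # ys)) = (\<Sum>w\<in>set xs. osimplex xs (w # ys))"
    using V xs by (intro sum.mono_neutral_right) auto
  also have "\<dots> = (\<Sum>i<length xs. osimplex xs (xs ! i # ys))"
    using xs by (intro sum.reindex_bij_betw[symmetric] bij_betw_nth) auto
  also have "\<dots> = (\<Sum>i<length xs. (-1) ^ i * osimplex (take i xs @ drop (Suc i) xs) ys)"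
  proof (rule sum.cong)
    fix i assume "i \<in> {..<length xs}"
    then have i: "xs = take i xs @ xs ! i # drop (Suc i) xs" "length (take i xs) = i"
      by (auto simp: id_take_nth_drop)
    then have d: "distinct (take i xs @ xs ! i # drop (Suc i) xs)" using xs(1) by simp
    have "osimplex xs (xs ! i # ys) = osimplex (take i xs @ xs ! i # drop (Suc i) xs) (xs ! i # ys)"
      using i by simp
    also have "\<dots> = (-1) ^ i * osimplex (xs ! i # take i xs @ drop (Suc i) xs) (xs ! i # ys)"
      using osimplex_move_front[OF d] i(2) by simp
    also have "\<dots> = (-1) ^ i * osimplex (take i xs @ drop (Suc i) xs) ys"
      using d by (subst osimplex_Cons) auto
    finally show "osimplex xs (xs ! i # ys) = (-1) ^ i * osimplex (take i xs @ drop (Suc i) xs) ys" .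
  qed simp
  finally show ?thesis by (simp add: osimplex_boundary_def sum_fun_apply scale_chain_def)
qed

section \<open>Coordinates of chains and the boundary operator\<close>

lemma chosen_order: "finite A \<Longrightarrow> distinct (chosen_order A) \<and> set (chosen_order A) = A"
  unfolding chosen_order_def by (rule someI_ex) (metis finite_distinct_list)

lemma chosen_order_in_ordered_simplices:
  assumes "finite V" "A \<subseteq> V" "card A = Suc m"
  shows "chosen_order A \<in> ordered_simplices V m"
  using assms chosen_order[of A] finite_subset[of A V] distinct_card[of "chosen_order A"]
  by (auto simp: ordered_simplices_def)

lemma ordered_simplices_set:
  "xs \<in> ordered_simplices V m \<Longrightarrow> set xs \<subseteq> V \<and> card (set xs) = Suc m"
  by (auto simp: ordered_simplices_def distinct_card)

lemma mset_chosen_order: "distinct xs \<Longrightarrow> mset (chosen_order (set xs)) = mset xs"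
  using chosen_order[of "set xs"] set_eq_iff_mset_eq_distinct by blast

lemma osimplex_chosen_order_eq_0:
  assumes "finite A" "A \<noteq> set xs"
  shows "osimplex (chosen_order A) xs = 0"
  using assms chosen_order[of A] by (metis osimplex_eq_0 set_mset_mset)

lemma chain_expansion:
  assumes V: "finite V" and c: "c \<in> chains V m"
  shows "c = (\<Sum>A | A \<subseteq> V \<and> card A = Suc m.
                scale_chain (c (chosen_order A)) (osimplex (chosen_order A)))"
proof
  fix xs
  let ?I = "{A. A \<subseteq> V \<and> card A = Suc m}" and ?o = chosen_order
  have finA: "finite A" if "A \<in> ?I" for A using that V finite_subset by auto
  have finI: "finite ?I" using V by simp
  show "c xs = (\<Sum>A\<in>?I. scale_chain (c (?o A)) (osimplex (?o A))) xs"
  proof (cases "xs \<in> ordered_simplices V m")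
    case True
    then have d: "distinct xs" and I: "set xs \<in> ?I"
      by (auto simp: ordered_simplices_def distinct_card)
    have "(\<Sum>A\<in>?I. c (?o A) * osimplex (?o A) xs) = (\<Sum>A\<in>{set xs}. c (?o A) * osimplex (?o A) xs)"
    proof (rule sum.mono_neutral_right)
      show "\<forall>A\<in>?I - {set xs}. c (?o A) * osimplex (?o A) xs = 0"
        using osimplex_chosen_order_eq_0[OF finA] by auto
    qed (use I finI in auto)
    also have "\<dots> = c xs"
    proof -
      let ?y = "?o (set xs)"
      have dy: "distinct ?y" using chosen_order by blast
      have "alternating (\<lambda>zs. c ?y * osimplex ?y zs)"
        using alternating_osimplex[OF dy] by (simp add: alternating_def)
      then have "c xs = c ?y * osimplex ?y xs"
        using c mset_chosen_order[OF d] osimplex_self[OF dy]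
        by (intro alternating_eqI[of c _ xs ?y]) (auto simp: chains_iff)
      then show ?thesis by simp
    qed
    finally show ?thesis by (simp add: sum_fun_apply scale_chain_def)
  next
    case False
    have "osimplex (?o A) xs = 0" if "A \<in> ?I" for A
      using False osimplex_in_chains[OF chosen_order_in_ordered_simplices[OF V, of A m]] that
      by (auto simp: chains_iff)
    moreover have "c xs = 0" using c False by (auto simp: chains_iff)
    ultimately show ?thesis by (simp add: sum_fun_apply scale_chain_def)
  qed
qed

lemma boundary_coeff:
  assumes V: "finite V" and c: "c \<in> chains V m"
  shows "boundary V m c ys = (\<Sum>w\<in>V. c (w # ys))"
proof -
  let ?I = "{A. A \<subseteq> V \<and> card A = Suc m}" and ?o = chosen_order
  have "boundary V m c ys = (\<Sum>A\<in>?I. c (?o A) * (\<Sum>w\<in>V. osimplex (?o A) (w # ys)))"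
    unfolding boundary_def sum_fun_apply scale_chain_def
  proof (rule sum.cong)
    fix A assume "A \<in> ?I"
    then have "?o A \<in> ordered_simplices V m"
      using V chosen_order_in_ordered_simplices by blast
    then show "c (?o A) * osimplex_boundary (?o A) ys
        = c (?o A) * (\<Sum>w\<in>V. osimplex (?o A) (w # ys))"
      using osimplex_boundary_coeff[OF V] by (auto simp: ordered_simplices_def)
  qed simp
  also have "\<dots> = (\<Sum>w\<in>V. \<Sum>A\<in>?I. c (?o A) * osimplex (?o A) (w # ys))"
    unfolding sum_distrib_left by (rule sum.swap)
  also have "\<dots> = (\<Sum>w\<in>V. c (w # ys))"
    by (subst (2) chain_expansion[OF V c]) (simp add: sum_fun_apply scale_chain_def)
  finally show ?thesis .
qed

lemma boundary_osimplex:
  assumes "finite V" "xs \<in> ordered_simplices V m"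
  shows "boundary V m (osimplex xs) = osimplex_boundary xs"
proof
  fix ys
  show "boundary V m (osimplex xs) ys = osimplex_boundary xs ys"
    using assms osimplex_boundary_coeff[OF assms(1), of xs ys]
    by (simp add: boundary_coeff[OF assms(1) osimplex_in_chains] ordered_simplices_def)
qed

lemma boundary_uminus: "boundary V m (- c) = - boundary V m c"
  by (rule ext) (simp add: boundary_def sum_fun_apply scale_chain_def sum_negf)

lemma boundary_sum: "boundary V m (\<Sum>i\<in>I. f i) = (\<Sum>i\<in>I. boundary V m (f i))"
proof
  fix ys
  show "boundary V m (\<Sum>i\<in>I. f i) ys = (\<Sum>i\<in>I. boundary V m (f i)) ys"
    unfolding boundary_def sum_fun_apply scale_chain_def sum_distrib_right by (rule sum.swap)
qed

lemma boundary_affine: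
  "boundary V m (\<lambda>i. x i + t * (y i - w i)) ys
     = boundary V m x ys + t * (boundary V m y ys - boundary V m w ys)"
  unfolding boundary_def sum_fun_apply scale_chain_def
  by (simp add: sum_distrib_left algebra_simps sum.distrib sum_subtractf)

lemma chains_affine:
  assumes "x \<in> chains V m" "y \<in> chains V m" "w \<in> chains V m"
  shows "(\<lambda>i. x i + t * (y i - w i)) \<in> chains V m"
proof -
  have "x xs + t * (y xs - w xs) = 0" if "xs \<notin> ordered_simplices V m" for xs
  proof -
    have "x xs = 0" "y xs = 0" "w xs = 0" using assms that unfolding chains_iff by blast+
    then show ?thesis by simp
  qed
  moreover have "alternating (\<lambda>i. x i + t * (y i - w i))"
    using assms by (simp add: alternating_def chains_iff algebra_simps)
  ultimately show ?thesis unfolding chains_iff by blast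
qed

lemma oriented_simplices_subset_chains: "oriented_simplices V m \<subseteq> chains V m"
  using osimplex_in_chains[of _ V m] by (auto simp: oriented_simplices_def chains_def)

lemma chains_sum:
  assumes "\<And>i. i \<in> I \<Longrightarrow> f i \<in> chains V m"
  shows "(\<Sum>i\<in>I. f i) \<in> chains V m"
proof -
  have "xs \<in> ordered_simplices V m" if nz: "(\<Sum>i\<in>I. f i) xs \<noteq> 0" for xs
  proof -
    obtain i where "i \<in> I" "f i xs \<noteq> 0"
      using nz unfolding sum_fun_apply by (meson sum.neutral)
    then show ?thesis using assms by (auto simp: chains_iff)
  qed
  moreover have "alternating (\<Sum>i\<in>I. f i)"
    using alternating_sum_scale[of I f "\<lambda>_. 1"] assms by (simp add: chains_iff scale_chain_def)
  ultimately show ?thesis by (auto simp: chains_iff)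
qed

section \<open>Fillings of cycles\<close>

lemma boundary_alternating:
  assumes V: "finite V" and c: "c \<in> chains V m"
  shows "alternating (boundary V m c)"
  using c alternating_Cons[of c]
  by (auto simp: alternating_def boundary_coeff[OF V c] chains_iff sum_distrib_left intro!: sum.cong)

text \<open>
  The cone from any vertex \<open>v\<close> over the part of the cycle \<open>\<kappa>\<close> that avoids \<open>v\<close> fills \<open>\<kappa>\<close>: on tuples
  without \<open>v\<close> its boundary agrees with \<open>\<kappa>\<close> by construction, and on tuples \<open>v # zs\<close> because the
  coefficients of \<open>w # zs\<close> in \<open>\<kappa>\<close> sum to zero over \<open>w\<close>.
\<close>

lemma cycle_has_filling:
  assumes V: "finite V" and k: "\<kappa> \<in> chains V m" and cyc: "boundary V m \<kappa> = 0"
  obtains \<alpha> where "\<alpha> \<in> chains V (Suc m)" "boundary V (Suc m) \<alpha> = \<kappa>"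
proof (cases "V = {}")
  case True
  then have "\<kappa> = 0" using k by (force simp: chains_iff ordered_simplices_def)
  moreover have "(0::'a chain) \<in> chains V (Suc m)" by (simp add: chains_iff alternating_def)
  moreover have "boundary V (Suc m) 0 = 0" 
    unfolding boundary_def by (rule sum.neutral) (auto simp: scale_chain_def)
  ultimately show ?thesis using that by metis
next
  case False
  then obtain v where v: "v \<in> V" by blast
  let ?o = chosen_order
  define J where "J = {A. A \<subseteq> V - {v} \<and> card A = Suc m}"
  define \<alpha> where "\<alpha> = (\<Sum>A\<in>J. scale_chain (\<kappa> (?o A)) (osimplex (v # ?o A)))"
  have ordJ: "v # ?o A \<in> ordered_simplices V (Suc m)" if "A \<in> J" for A
    using chosen_order_in_ordered_simplices[of "V - {v}" A m] that V v
    by (auto simp: J_def ordered_simplices_def)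
  have osJ: "osimplex (v # ?o A) \<in> chains V (Suc m)" if "A \<in> J" for A
    using osimplex_in_chains ordJ[OF that] by blast
  have a: "\<alpha> \<in> chains V (Suc m)"
  proof -
    have "alternating \<alpha>"
      unfolding \<alpha>_def using osJ by (intro alternating_sum_scale) (auto simp: chains_iff)
    moreover have "\<alpha> xs = 0" if "xs \<notin> ordered_simplices V (Suc m)" for xs
      unfolding \<alpha>_def sum_fun_apply scale_chain_def using osJ that
      by (intro sum.neutral) (auto simp: chains_iff)
    ultimately show ?thesis by (auto simp: chains_iff)
  qed
  have k0: "\<kappa> xs = 0" if "xs \<notin> ordered_simplices V m" for xs
    using k that by (auto simp: chains_iff)
  have a_v: "\<alpha> (v # zs) = \<kappa> zs" if "v \<notin> set zs" for zs
  proof -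
    let ?I = "{A. A \<subseteq> V \<and> card A = Suc m}"
    have "\<alpha> (v # zs) = (\<Sum>A\<in>J. \<kappa> (?o A) * osimplex (?o A) zs)"
      unfolding \<alpha>_def sum_fun_apply scale_chain_def
      by (rule sum.cong) (use ordJ in \<open>auto simp: ordered_simplices_def osimplex_Cons\<close>)
    also have "\<dots> = (\<Sum>A\<in>?I. \<kappa> (?o A) * osimplex (?o A) zs)"
    proof (rule sum.mono_neutral_left)
      show "\<forall>A\<in>?I - J. \<kappa> (?o A) * osimplex (?o A) zs = 0"
      proof
        fix A assume A: "A \<in> ?I - J"
        then have "v \<in> set (?o A)"
          using chosen_order[of A] V by (auto simp: J_def finite_subset)
        then have "osimplex (?o A) zs = 0" using that by (metis osimplex_eq_0 set_mset_mset)
        then show "\<kappa> (?o A) * osimplex (?o A) zs = 0" by simp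
      qed
    qed (use V in \<open>auto simp: J_def\<close>)
    also have "\<dots> = \<kappa> zs"
      by (subst (2) chain_expansion[OF V k]) (simp add: sum_fun_apply scale_chain_def)
    finally show ?thesis .
  qed
  have a_not_v: "\<alpha> xs = 0" if "v \<notin> set xs" for xs
    unfolding \<alpha>_def sum_fun_apply scale_chain_def
  proof (rule sum.neutral, rule ballI)
    fix A
    have "mset xs \<noteq> mset (v # ?o A)" using that by (metis list.set_intros(1) set_mset_mset)
    then show "\<kappa> (?o A) * osimplex (v # ?o A) xs = 0" by (simp add: osimplex_eq_0)
  qed
  have alt_a: "alternating \<alpha>" and alt_k: "alternating \<kappa>" using a k by (auto simp: chains_iff)
  have a_v_v: "\<alpha> (v # xs) = 0" if "v \<in> set xs" for xs
    using a that by (auto simp: chains_iff ordered_simplices_def)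
  have bd_v: "(\<Sum>w\<in>V. \<alpha> (w # v # zs)) = \<kappa> (v # zs)" for zs
  proof (cases "v \<in> set zs")
    case True
    have "(\<Sum>w\<in>V. \<alpha> (w # v # zs)) = 0"
      using a True by (intro sum.neutral) (auto simp: chains_iff ordered_simplices_def)
    then show ?thesis using k0[of "v # zs"] True by (auto simp: ordered_simplices_def)
  next
    case False
    have "(\<Sum>w\<in>V. \<alpha> (w # v # zs)) = - (\<Sum>w\<in>V. \<alpha> (v # w # zs))"
      by (simp add: alternating_swap_first[OF alt_a, of _ v] sum_negf)
    also have "(\<Sum>w\<in>V. \<alpha> (v # w # zs)) = (\<Sum>w\<in>V - {v}. \<kappa> (w # zs))"
    proof -
      have "\<alpha> (v # w # zs) = \<kappa> (w # zs)" if "w \<in> V - {v}" for w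
        using a_v[of "w # zs"] that False by auto
      then show ?thesis using v V by (simp add: sum.remove[of _ v] a_v_v)
    qed
    also have "\<dots> = (\<Sum>w\<in>V. \<kappa> (w # zs)) - \<kappa> (v # zs)"
      using v V by (simp add: sum_diff1)
    also have "(\<Sum>w\<in>V. \<kappa> (w # zs)) = 0"
      using boundary_coeff[OF V k, of zs] cyc by simp
    finally show ?thesis by simp
  qed
  have "boundary V (Suc m) \<alpha> = \<kappa>"
  proof
    fix ys
    show "boundary V (Suc m) \<alpha> ys = \<kappa> ys"
    proof (cases "v \<in> set ys")
      case True
      then obtain as bs where ys: "ys = as @ v # bs" by (meson split_list)
      show ?thesis
        by (rule alternating_eqI[OF boundary_alternating[OF V a] alt_k, of ys "v # as @ bs"])
          (simp_all add: ys boundary_coeff[OF V a] bd_v)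
    next
      case False
      have "(\<Sum>w\<in>V. \<alpha> (w # ys)) = \<alpha> (v # ys)"
      proof -
        have "(\<Sum>w\<in>V - {v}. \<alpha> (w # ys)) = 0"
          using False by (intro sum.neutral) (auto intro!: a_not_v)
        then show ?thesis using v V by (simp add: sum.remove[of _ v])
      qed
      then show ?thesis using a_v[OF False] by (simp add: boundary_coeff[OF V a])
    qed
  qed
  with a show ?thesis using that by blast
qed

lemma minimal_filling:
  assumes V: "finite V" and k: "\<kappa> \<in> chains V m" and cyc: "boundary V m \<kappa> = 0"
  obtains \<alpha> where "\<alpha> \<in> chains V (Suc m)" "boundary V (Suc m) \<alpha> = \<kappa>"
    "\<And>\<beta>. \<beta> \<in> chains V (Suc m) \<Longrightarrow> boundary V (Suc m) \<beta> = \<kappa> \<Longrightarrow>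
       l1_norm V (Suc m) \<alpha> \<le> l1_norm V (Suc m) \<beta>"
proof -
  let ?J = "{A. A \<subseteq> V \<and> card A = Suc (Suc m)}"
  let ?I = "chosen_order ` ?J"
  let ?X = "{\<alpha> \<in> chains V (Suc m). boundary V (Suc m) \<alpha> = \<kappa>}"
  have "inj_on chosen_order ?J"
  proof (rule inj_on_inverseI)
    fix A assume "A \<in> ?J"
    then have "finite A" using V finite_subset by blast
    then show "set (chosen_order A) = A" using chosen_order by blast
  qed
  then have norm: "l1_norm V (Suc m) c = (\<Sum>xs\<in>?I. \<bar>c xs\<bar>)" for c :: "'a chain"
    by (simp add: l1_norm_def sum.reindex)
  have aff: "(\<lambda>i. x i + t * (y i - w i)) \<in> ?X" if "x \<in> ?X" "y \<in> ?X" "w \<in> ?X" for x y w t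
  proof -
    have "(\<lambda>i. x i + t * (y i - w i)) \<in> chains V (Suc m)"
      using that by (intro chains_affine) simp_all
    moreover have "boundary V (Suc m) (\<lambda>i. x i + t * (y i - w i)) = \<kappa>"
      by (rule ext) (use that in \<open>simp add: boundary_affine\<close>)
    ultimately show ?thesis by simp
  qed
  obtain \<alpha> where "\<alpha> \<in> ?X" "\<And>\<beta>. \<beta> \<in> ?X \<Longrightarrow> (\<Sum>xs\<in>?I. \<bar>\<alpha> xs\<bar>) \<le> (\<Sum>xs\<in>?I. \<bar>\<beta> xs\<bar>)"
  proof (rule l1_min_attained[of ?I ?X])
    show "finite ?I" using V by simp
    show "?X \<noteq> {}" using cycle_has_filling[OF V k cyc] by blast
  qed (use aff in blast)+
  then show ?thesis using that norm by auto
qed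

section \<open>Linear functionals on chains\<close>

text \<open>
  The linear extension of \<open>\<phi>\<close> to real values on chains, computed with the chosen orientations; only
  the values of \<open>\<phi>\<close> on these orientations enter.
\<close>

definition linear_ext :: "'a set \<Rightarrow> nat \<Rightarrow> ('a chain \<Rightarrow> real) \<Rightarrow> 'a chain \<Rightarrow> real" where
  "linear_ext V m \<phi> c =
     (\<Sum>A | A \<subseteq> V \<and> card A = Suc m. of_rat (c (chosen_order A)) * \<phi> (osimplex (chosen_order A)))"

lemma linear_ext_sum_scale:
  "linear_ext V m \<phi> (\<Sum>i\<in>I. scale_chain (a i) (f i)) = (\<Sum>i\<in>I. of_rat (a i) * linear_ext V m \<phi> (f i))"
  unfolding linear_ext_def sum_fun_apply scale_chain_def of_rat_sum of_rat_mult sum_distrib_right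
    sum_distrib_left mult.assoc by (rule sum.swap)

lemma linear_ext_sum: "linear_ext V m \<phi> (\<Sum>i\<in>I. f i) = (\<Sum>i\<in>I. linear_ext V m \<phi> (f i))"
  using linear_ext_sum_scale[of V m \<phi> "\<lambda>_. 1" f I] by (simp add: scale_chain_def)

lemma linear_ext_uminus: "linear_ext V m \<phi> (- c) = - linear_ext V m \<phi> c"
  by (simp add: linear_ext_def of_rat_minus sum_negf)

lemma oriented_simplices_uminus: "T \<in> oriented_simplices V m \<Longrightarrow> - T \<in> oriented_simplices V m"
  by (auto simp: oriented_simplices_def)

lemma linear_ext_oriented_simplex:
  assumes V: "finite V"
    and odd: "\<And>T. T \<in> oriented_simplices V m \<Longrightarrow> \<phi> T = - \<phi> (- T)"
    and T: "T \<in> oriented_simplices V m"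
  shows "linear_ext V m \<phi> T = \<phi> T"
proof -
  have pos: "linear_ext V m \<phi> (osimplex xs) = \<phi> (osimplex xs)"
    if xs: "xs \<in> ordered_simplices V m" for xs
  proof -
    let ?I = "{A. A \<subseteq> V \<and> card A = Suc m}" and ?o = chosen_order
    let ?y = "?o (set xs)"
    have d: "distinct xs" using xs by (simp add: ordered_simplices_def)
    have dy: "distinct ?y" and y: "?y \<in> ordered_simplices V m"
      using chosen_order[of "set xs"] chosen_order_in_ordered_simplices[OF V]
        ordered_simplices_set[OF xs] by auto
    obtain q where q: "q permutes {..<length ?y}" "permute_list q ?y = xs"
      using mset_chosen_order[OF d] by (metis mset_eq_permutation)
    have os: "osimplex xs = scale_chain (of_int (sign q)) (osimplex ?y)"
      using osimplex_permute_list[OF q(1)] q(2) by simp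
    have "linear_ext V m \<phi> (osimplex xs)
        = (\<Sum>A\<in>{set xs}. of_rat (osimplex xs (?o A)) * \<phi> (osimplex (?o A)))"
      unfolding linear_ext_def
    proof (rule sum.mono_neutral_right)
      show "\<forall>A\<in>?I - {set xs}. of_rat (osimplex xs (?o A)) * \<phi> (osimplex (?o A)) = 0"
      proof
        fix A assume A: "A \<in> ?I - {set xs}"
        then have "set (?o A) = A" using V chosen_order finite_subset by blast
        then have "osimplex xs (?o A) = 0"
          using A by (metis DiffD2 osimplex_eq_0 set_mset_mset singletonI)
        then show "of_rat (osimplex xs (?o A)) * \<phi> (osimplex (?o A)) = 0" by simp
      qed
    qed (use ordered_simplices_set[OF xs] V in auto)
    also have "\<dots> = of_int (sign q) * \<phi> (osimplex ?y)"
      using osimplex_self[OF dy] by (simp add: os scale_chain_def)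
    also have "\<dots> = \<phi> (osimplex xs)"
    proof (cases "sign q = 1")
      case True
      then show ?thesis by (simp add: os scale_chain_def)
    next
      case False
      then have "sign q = -1" by (simp add: sign_def split: if_splits)
      moreover from this have "osimplex xs = - osimplex ?y"
        by (simp add: os scale_chain_def fun_eq_iff)
      moreover have "osimplex ?y \<in> oriented_simplices V m"
        using y by (auto simp: oriented_simplices_def)
      ultimately show ?thesis using odd[of "osimplex ?y"] by simp
    qed
    finally show ?thesis .
  qed
  obtain xs where xs: "xs \<in> ordered_simplices V m" "T = osimplex xs \<or> T = - osimplex xs"
    using T by (auto simp: oriented_simplices_def)
  then have "osimplex xs \<in> oriented_simplices V m" by (auto simp: oriented_simplices_def)
  then show ?thesis using xs pos[OF xs(1)] odd[of "osimplex xs"] by (auto simp: linear_ext_uminus)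
qed

text \<open>
  Weak duality. Applying the hypothesis to a simplex and to its reverse bounds the linear extension
  on its boundary by 1 in absolute value.
\<close>

lemma linear_ext_boundary_le:
  assumes V: "finite V"
    and odd: "\<And>T. T \<in> oriented_simplices V d \<Longrightarrow> \<phi> T = - \<phi> (- T)"
    and le: "\<And>T B. T \<in> oriented_simplices V (Suc d) \<Longrightarrow> boundary_facets V d T B \<Longrightarrow>
           (\<Sum>i < d + 2. \<phi> (B i)) \<le> 1"
  shows "linear_ext V d \<phi> (boundary V (Suc d) \<alpha>) \<le> of_rat (l1_norm V (Suc d) \<alpha>)"
proof -
  let ?I = "{A. A \<subseteq> V \<and> card A = Suc (Suc d)}" and ?o = chosen_order
  have bound: "\<bar>linear_ext V d \<phi> (osimplex_boundary xs)\<bar> \<le> 1"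
    if xs: "xs \<in> ordered_simplices V (Suc d)" for xs
  proof -
    define B where "B i = scale_chain ((-1) ^ i) (osimplex (take i xs @ drop (Suc i) xs))" for i
    have len: "length xs = d + 2" using xs by (simp add: ordered_simplices_def)
    have B: "B i \<in> oriented_simplices V d" if "i < d + 2" for i
    proof -
      let ?f = "take i xs @ drop (Suc i) xs"
      have xs_split: "xs = take i xs @ xs ! i # drop (Suc i) xs"
        using that len by (simp add: id_take_nth_drop)
      then have "distinct (take i xs @ xs ! i # drop (Suc i) xs)"
        using xs by (simp add: ordered_simplices_def)
      then have "distinct ?f" by auto
      moreover have "set ?f \<subseteq> V"
        using xs set_take_subset[of i xs] set_drop_subset[of "Suc i" xs]
        by (auto simp: ordered_simplices_def)
      moreover have "length ?f = Suc d" using len that by simp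
      ultimately have "?f \<in> ordered_simplices V d" by (simp add: ordered_simplices_def)
      moreover have "B i = osimplex ?f \<or> B i = - osimplex ?f"
        by (cases "even i") (auto simp: B_def scale_chain_def)
      ultimately show ?thesis unfolding oriented_simplices_def by blast
    qed
    have sumB: "osimplex_boundary xs = (\<Sum>i<d+2. B i)"
      by (simp add: osimplex_boundary_def B_def len)
    have T: "osimplex xs \<in> oriented_simplices V (Suc d)"
      using xs by (auto simp: oriented_simplices_def)
    have val: "linear_ext V d \<phi> (osimplex_boundary xs) = (\<Sum>i<d+2. \<phi> (B i))"
      unfolding sumB linear_ext_sum
      by (rule sum.cong) (use linear_ext_oriented_simplex[of V d \<phi>, OF V odd] B in auto)
    have "(\<Sum>i<d+2. \<phi> (B i)) \<le> 1"
      by (rule le[OF T]) (simp add: boundary_facets_def B boundary_osimplex[OF V xs] sumB)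
    moreover have "(\<Sum>i<d+2. \<phi> (- B i)) \<le> 1"
    proof (rule le[OF oriented_simplices_uminus[OF T]])
      have "\<forall>i<d+2. - B i \<in> oriented_simplices V d"
        using B oriented_simplices_uminus by blast
      then show "boundary_facets V d (- osimplex xs) (\<lambda>i. - B i)"
        by (simp add: boundary_facets_def boundary_uminus boundary_osimplex[OF V xs] sumB sum_negf del: sum.lessThan_Suc)
    qed
    moreover have "(\<Sum>i<d+2. \<phi> (- B i)) = - (\<Sum>i<d+2. \<phi> (B i))"
      unfolding sum_negf[symmetric] by (rule sum.cong) (use odd B in force)+
    ultimately show ?thesis unfolding val by linarith
  qed
  have "linear_ext V d \<phi> (boundary V (Suc d) \<alpha>)
      = (\<Sum>A\<in>?I. of_rat (\<alpha> (?o A)) * linear_ext V d \<phi> (osimplex_boundary (?o A)))"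
    unfolding boundary_def by (rule linear_ext_sum_scale)
  also have "\<dots> \<le> (\<Sum>A\<in>?I. \<bar>of_rat (\<alpha> (?o A))\<bar>)"
  proof (rule sum_mono)
    fix A assume "A \<in> ?I"
    then have "\<bar>linear_ext V d \<phi> (osimplex_boundary (?o A))\<bar> \<le> 1"
      using bound chosen_order_in_ordered_simplices[OF V] by blast
    then have "\<bar>of_rat (\<alpha> (?o A)) * linear_ext V d \<phi> (osimplex_boundary (?o A))\<bar>
        \<le> \<bar>of_rat (\<alpha> (?o A))\<bar>"
      unfolding abs_mult by (rule mult_left_le) simp
    then show "of_rat (\<alpha> (?o A)) * linear_ext V d \<phi> (osimplex_boundary (?o A))
        \<le> \<bar>of_rat (\<alpha> (?o A))\<bar>" by linarith
  qed
  also have "\<dots> = of_rat (l1_norm V (Suc d) \<alpha>)"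
    by (simp add: l1_norm_def of_rat_sum)
  finally show ?thesis .
qed

section \<open>The lower bound on the filling volume\<close>

lemma complex_chain_is_cycle:
  assumes "admissible_complex d K F"
  shows "finite (\<Union>K)" "complex_chain d K F \<in> chains (\<Union>K) d"
    "boundary (\<Union>K) d (complex_chain d K F) = 0"
    "\<And>s. s \<in> facets d K \<Longrightarrow> F s \<in> oriented_simplices (\<Union>K) d"
proof -
  show "finite (\<Union>K)"
    using assms by (auto simp: admissible_complex_def abstract_simplicial_complex_def)
  show F: "F s \<in> oriented_simplices (\<Union>K) d" if "s \<in> facets d K" for s
  proof -
    have "s \<subseteq> \<Union>K" using that by (auto simp: facets_def)
    moreover have "F s \<in> oriented_simplices s d"
      using assms that by (simp add: admissible_complex_def)
    ultimately show ?thesis by (fastforce simp: oriented_simplices_def ordered_simplices_def)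
  qed
  show "complex_chain d K F \<in> chains (\<Union>K) d"
    unfolding complex_chain_def using F oriented_simplices_subset_chains by (intro chains_sum) blast
  show "boundary (\<Union>K) d (complex_chain d K F) = 0"
    using assms by (simp add: complex_chain_def boundary_sum admissible_complex_def)
qed

theorem lemma1:
  fixes d :: nat and K :: "'a set set" and F :: "'a set \<Rightarrow> 'a chain"
    and \<phi> :: "'a chain \<Rightarrow> real"
  assumes "d \<ge> 1"
    and "admissible_complex d K F"
    and "\<And>T. T \<in> oriented_simplices (\<Union>K) d \<Longrightarrow> \<phi> T = - \<phi> (- T)"
    and "\<And>T B. T \<in> oriented_simplices (\<Union>K) (Suc d) \<Longrightarrow> boundary_facets (\<Union>K) d T B \<Longrightarrow>
           (\<Sum>i < d + 2. \<phi> (B i)) \<le> 1"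
  shows "(\<Sum>s \<in> facets d K. \<phi> (F s)) \<le> of_rat (V_rat d K F)"
proof -
  note cycle = complex_chain_is_cycle[OF assms(2)]
  obtain \<alpha> where \<alpha>: "\<alpha> \<in> chains (\<Union>K) (Suc d)"
      "boundary (\<Union>K) (Suc d) \<alpha> = complex_chain d K F"
    and min: "\<And>\<beta>. \<beta> \<in> chains (\<Union>K) (Suc d) \<Longrightarrow>
       boundary (\<Union>K) (Suc d) \<beta> = complex_chain d K F \<Longrightarrow>
       l1_norm (\<Union>K) (Suc d) \<alpha> \<le> l1_norm (\<Union>K) (Suc d) \<beta>"
    using minimal_filling[OF cycle(1-3)] by blast
  \<comment> \<open>\<open>LEAST\<close> is only meaningful because a minimum exists.\<close>
  have V: "V_rat d K F = l1_norm (\<Union>K) (Suc d) \<alpha>"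
    unfolding V_rat_def by (rule Least_equality) (use \<alpha> min in auto)
  have "(\<Sum>s\<in>facets d K. \<phi> (F s)) = linear_ext (\<Union>K) d \<phi> (complex_chain d K F)"
    unfolding complex_chain_def linear_ext_sum
    using linear_ext_oriented_simplex[of "\<Union>K" d \<phi>, OF cycle(1) assms(3) cycle(4)] by (intro sum.cong) auto
  also have "\<dots> \<le> of_rat (l1_norm (\<Union>K) (Suc d) \<alpha>)"
    using linear_ext_boundary_le[of "\<Union>K" d \<phi> \<alpha>, OF cycle(1) assms(3,4)] by (simp add: \<alpha>(2))
  finally show ?thesis by (simp add: V)
qed

end
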